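(* Let $1\le M\le d$ and let $\boldsymbol p$ be a $d$-dimensional probability vector. If there exist $M$ perfectly distinguishable quantum states $\{\rho^{(n)}\}_{n=1}^M$ on $\mathbb{C}^d$, all with the same classical version $\boldsymbol p$, then $\max_k p_k\le 1/M$. Equivalently, $\mathcal{A}_d^M\subseteq\mathcal{P}_d^M$.
   Context: Fix an orthonormal basis $\{|k\rangle\}_{k=1}^d$ of $\mathbb{C}^d$. A quantum state is a positive semidefinite $d\times d$ matrix $\rho$ with $\mathrm{Tr}\,\rho=1$. Its classical version is the probability vector $\boldsymbol p$ with $p_k=\langle k|\rho|k\rangle$. A set of states is perfectly distinguishable if the states have pairwise orthogonal supports (i.e. $\rho^{(m)}\rho^{(n)}=0$ for $m\ne n$). $\Delta_d$ is the set of $d$-dimensional probability vectors. The $M$-distinguishability region $\mathcal{A}_d^M\subseteq\Delta_d$ is the set of all $\boldsymbol p\in\Delta_d$ for which there exist $M$ perfectly distinguishable quantum states all having classical version $\boldsymbol p$. $\boldsymbol v^M\in\Delta_d$ is the vector whose first $M$ entries equal $1/M$ and whose other entries are $0$. The permutohedron $\mathcal{P}_d^M$ is the convex hull of all permutations of the coordinates of $\boldsymbol v^M$. *)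

theory Defs
  imports "HOL-Analysis.Analysis"
begin

text \<open>The Hermitian inner product, conjugate-linear in the first argument. The library's
  inner product on this type is only its real part.\<close>

definition cinner :: "complex ^ 'd \<Rightarrow> complex ^ 'd \<Rightarrow> complex" where
  "cinner x y = (\<Sum>k\<in>UNIV. cnj (x $ k) * y $ k)"

text \<open>Families of vectors are indexed by the coordinate type itself, so a basis has exactly
  \<open>CARD('d)\<close> members.\<close>

definition orthonormal_basis :: "('d \<Rightarrow> complex ^ 'd) \<Rightarrow> bool" where
  "orthonormal_basis b \<longleftrightarrow>
     (\<forall>i j. cinner (b i) (b j) = (if i = j then 1 else 0)) \<and> vec.span (range b) = UNIV"

definition hermitian :: "complex ^ 'd ^ 'd \<Rightarrow> bool" where
  "hermitian A \<longleftrightarrow> (\<forall>i j. A $ i $ j = cnj (A $ j $ i))"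

text \<open>For Hermitian \<open>A\<close> the quadratic form is real-valued, so taking \<open>Re\<close> loses nothing.\<close>

definition pos_semidef :: "complex ^ 'd ^ 'd \<Rightarrow> bool" where
  "pos_semidef A \<longleftrightarrow> hermitian A \<and> (\<forall>x. 0 \<le> Re (cinner x (A *v x)))"

definition quantum_state :: "complex ^ 'd ^ 'd \<Rightarrow> bool" where
  "quantum_state \<rho> \<longleftrightarrow> pos_semidef \<rho> \<and> trace \<rho> = 1"

definition has_classical_version ::
    "('d \<Rightarrow> complex ^ 'd) \<Rightarrow> complex ^ 'd ^ 'd \<Rightarrow> real ^ 'd \<Rightarrow> bool" where
  "has_classical_version b \<rho> p \<longleftrightarrow>
     (\<forall>k. complex_of_real (p $ k) = cinner (b k) (\<rho> *v b k))"

definition perfectly_distinguishable :: "'i set \<Rightarrow> ('i \<Rightarrow> complex ^ 'd ^ 'd) \<Rightarrow> bool" where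
  "perfectly_distinguishable I \<rho> \<longleftrightarrow> (\<forall>m\<in>I. \<forall>n\<in>I. m \<noteq> n \<longrightarrow> \<rho> m ** \<rho> n = 0)"

definition prob_simplex :: "(real ^ 'd) set" where
  "prob_simplex = {p. (\<forall>k. 0 \<le> p $ k) \<and> (\<Sum>k\<in>UNIV. p $ k) = 1}"

definition distinguishability_region ::
    "('d \<Rightarrow> complex ^ 'd) \<Rightarrow> nat \<Rightarrow> (real ^ 'd) set" where
  "distinguishability_region b M =
     {p \<in> prob_simplex.
        \<exists>\<rho> :: nat \<Rightarrow> complex ^ 'd ^ 'd.
          (\<forall>n\<in>{1..M}. quantum_state (\<rho> n) \<and> has_classical_version b (\<rho> n) p) \<and>
          perfectly_distinguishable {1..M} \<rho>}"

text \<open>The linear order on the index type only serves to make sense of ``the first \<open>M\<close> entries'':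
  \<open>card {j. j < k}\<close> is the zero-based position of \<open>k\<close>.\<close>

definition flat_vector :: "nat \<Rightarrow> real ^ 'd::{finite,linorder}" where
  "flat_vector M = (\<chi> k. if card {j. j < k} < M then 1 / real M else 0)"

definition permutohedron :: "nat \<Rightarrow> (real ^ 'd::{finite,linorder}) set" where
  "permutohedron M = convex hull {(\<chi> k. flat_vector M $ \<pi> k) | \<pi>. \<pi> permutes UNIV}"

end

theory Submission
  imports Defs
begin

text \<open>For a unit basis vector \<open>x = b k\<close> put \<open>y = \<Sum>n. \<rho>\<^sub>n x\<close>. Mutual orthogonality of the states and
  \<open>\<parallel>\<rho> x\<parallel>\<^sup>2 \<le> \<langle>x, \<rho> x\<rangle>\<close> give \<open>\<parallel>y\<parallel>\<^sup>2 \<le> M p\<^sub>k\<close>, while \<open>\<langle>x, y\<rangle> = M p\<^sub>k\<close>, so that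
  \<open>0 \<le> \<parallel>x - y\<parallel>\<^sup>2 \<le> 1 - M p\<^sub>k\<close>. For the inclusion in the permutohedron, an extreme point of the
  probability simplex cut by \<open>p\<^sub>k \<le> 1 / M\<close> has no coordinate strictly between \<open>0\<close> and \<open>1 / M\<close>:
  the coordinates add up to an integer multiple of \<open>1 / M\<close>, so there would be two such coordinates,
  and mass could be shifted between them in both directions. Krein--Milman does the rest.\<close>

section \<open>Algebra of the Hermitian inner product\<close>

lemma cinner_add_left: "cinner (x + y) z = cinner x z + cinner y z"
  by (simp add: cinner_def algebra_simps sum.distrib)

lemma cinner_add_right: "cinner x (y + z) = cinner x y + cinner x z"
  by (simp add: cinner_def algebra_simps sum.distrib)

lemma cinner_diff_left: "cinner (x - y) z = cinner x z - cinner y z"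
  by (simp add: cinner_def algebra_simps sum_subtractf)

lemma cinner_diff_right: "cinner x (y - z) = cinner x y - cinner x z"
  by (simp add: cinner_def algebra_simps sum_subtractf)

lemma cinner_scale_left: "cinner (c *s x) y = cnj c * cinner x y"
  by (simp add: cinner_def sum_distrib_left mult.assoc)

lemma cinner_scale_right: "cinner x (c *s y) = c * cinner x y"
  by (simp add: cinner_def sum_distrib_left mult.left_commute)

lemma cinner_sum_left: "cinner (\<Sum>n\<in>I. f n) y = (\<Sum>n\<in>I. cinner (f n) y)"
  by (induction I rule: infinite_finite_induct)
    (simp_all add: cinner_add_left, simp_all add: cinner_def)

lemma cinner_sum_right: "cinner x (\<Sum>n\<in>I. f n) = (\<Sum>n\<in>I. cinner x (f n))"
  by (induction I rule: infinite_finite_induct)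
    (simp_all add: cinner_add_right, simp_all add: cinner_def)

lemma cinner_commute: "cinner y x = cnj (cinner x y)"
  by (simp add: cinner_def mult.commute)

lemma cinner_self: "cinner x x = of_real (\<Sum>k\<in>UNIV. (cmod (x $ k))\<^sup>2)"
  unfolding cinner_def of_real_sum
  by (rule sum.cong) (simp_all only: complex_norm_square mult.commute)

lemma cinner_axis_left: "cinner (axis i 1) x = x $ i"
proof -
  have "cinner (axis i 1) x = (\<Sum>k\<in>UNIV. if k = i then x $ k else 0)"
    unfolding cinner_def by (rule sum.cong) (auto simp: axis_def)
  then show ?thesis by simp
qed

lemma cinner_hermitian:
  assumes "hermitian A"
  shows "cinner (A *v x) y = cinner x (A *v y)"
proof -
  have "cinner (A *v x) y = (\<Sum>i\<in>UNIV. \<Sum>j\<in>UNIV. cnj (A $ i $ j) * cnj (x $ j) * y $ i)"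
    by (simp add: cinner_def matrix_vector_mult_def sum_distrib_right)
  also have "\<dots> = (\<Sum>j\<in>UNIV. \<Sum>i\<in>UNIV. cnj (A $ i $ j) * cnj (x $ j) * y $ i)"
    by (rule sum.swap)
  also have "\<dots> = (\<Sum>j\<in>UNIV. \<Sum>i\<in>UNIV. cnj (x $ j) * (A $ j $ i * y $ i))"
  proof (intro sum.cong refl)
    fix i j
    have "A $ j $ i = cnj (A $ i $ j)"
      using assms unfolding hermitian_def by blast
    then show "cnj (A $ i $ j) * cnj (x $ j) * y $ i = cnj (x $ j) * (A $ j $ i * y $ i)"
      by simp
  qed
  also have "\<dots> = cinner x (A *v y)"
    by (simp add: cinner_def matrix_vector_mult_def sum_distrib_left)
  finally show ?thesis .
qed

section \<open>Cauchy-Schwarz for positive semidefinite matrices\<close>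

text \<open>A discriminant argument: for \<open>q > 0\<close> the quadratic in \<open>t\<close> is
  smallest at \<open>t = s / q\<close>, with value \<open>s * (r - s / q)\<close>. The coefficient
  \<open>s\<close> appears twice because it will be the squared modulus of an off-diagonal
  term.\<close>

lemma quadratic_nonneg_imp:
  fixes q r s :: real
  assumes "0 \<le> q" "0 \<le> r" "0 \<le> s" and nonneg: "\<And>t. 0 \<le> t\<^sup>2 * q - 2 * t * s + s * r"
  shows "s \<le> r * q"
proof (cases "s = 0 \<or> q = 0")
  case True
  \<comment> \<open>If \<open>q = 0\<close> the expression is affine in \<open>t\<close>; any
    \<open>t > r / 2\<close> forces \<open>s = 0\<close>, and \<open>r + 1\<close> is such a
    value.\<close>
  have "0 \<le> (r + 1)\<^sup>2 * q - 2 * (r + 1) * s + s * r"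
    by (rule nonneg)
  with True have "s = 0 \<or> s * (r + 2) \<le> 0"
    by (auto simp: algebra_simps)
  then have "s = 0"
    using assms by (auto simp: mult_le_0_iff)
  then show ?thesis using assms by simp
next
  case False
  then have "0 < q" "0 < s" using assms by auto
  have "0 \<le> s * (r - s / q)"
    using nonneg[of "s / q"] \<open>0 < q\<close> by (simp add: power2_eq_square field_simps)
  with \<open>0 < s\<close> have "s / q \<le> r"
    by (simp add: zero_le_mult_iff)
  with \<open>0 < q\<close> show ?thesis
    by (simp add: divide_le_eq)
qed

lemma pos_semidef_Cauchy_Schwarz:
  assumes "pos_semidef A"
  shows "(cmod (cinner u (A *v x)))\<^sup>2 \<le> Re (cinner u (A *v u)) * Re (cinner x (A *v x))"
proof (rule quadratic_nonneg_imp)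
  have herm: "hermitian A" and pos: "\<And>z. 0 \<le> Re (cinner z (A *v z))"
    using assms by (auto simp: pos_semidef_def)
  show "0 \<le> Re (cinner u (A *v u))" "0 \<le> Re (cinner x (A *v x))" by (rule pos)+
  fix t :: real
  define w where "w = cinner u (A *v x)"
  \<comment> \<open>Scaling \<open>u\<close> by \<open>w\<close> turns both cross terms into
    \<open>t\<close> times the squared modulus of \<open>w\<close>, so a real parameter
    \<open>t\<close> suffices although the space is complex.\<close>
  define z where "z = of_real t *s x - w *s u"
  have xu: "cinner x (A *v u) = cnj w"
    unfolding w_def using cinner_commute[of x "A *v u"] cinner_hermitian[OF herm, of u x] by simp
  have "cinner z (A *v z) = of_real (t\<^sup>2) * cinner x (A *v x) - 2 * of_real t * (w * cnj w)
      + (w * cnj w) * cinner u (A *v u)"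
    by (simp add: z_def matrix_vector_mult_diff_distrib vec.scale cinner_diff_left
        cinner_diff_right cinner_scale_left cinner_scale_right xu w_def[symmetric]
        power2_eq_square algebra_simps)
  then have "Re (cinner z (A *v z)) = t\<^sup>2 * Re (cinner x (A *v x)) - 2 * t * (cmod w)\<^sup>2
      + (cmod w)\<^sup>2 * Re (cinner u (A *v u))"
    by (simp add: complex_norm_square[symmetric] flip: of_real_power)
  with pos[of z] show "0 \<le> t\<^sup>2 * Re (cinner x (A *v x)) - 2 * t * (cmod (cinner u (A *v x)))\<^sup>2
      + (cmod (cinner u (A *v x)))\<^sup>2 * Re (cinner u (A *v u))"
    by (simp add: w_def)
qed simp

text \<open>This is the inequality \<open>\<rho>\<^sup>2 \<le> \<rho>\<close>, obtained without diagonalising \<open>\<rho>\<close>.\<close>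

lemma quantum_state_square_le:
  assumes "quantum_state \<rho>"
  shows "Re (cinner (\<rho> *v x) (\<rho> *v x)) \<le> Re (cinner x (\<rho> *v x))"
proof -
  have psd: "pos_semidef \<rho>" and tr: "trace \<rho> = 1"
    using assms by (auto simp: quantum_state_def)
  have diag: "cinner (axis i 1) (\<rho> *v axis i 1) = \<rho> $ i $ i" for i
    unfolding cinner_axis_left
    by (simp add: matrix_vector_mult_def axis_def if_distrib cong: if_cong)
  have "Re (cinner (\<rho> *v x) (\<rho> *v x)) = (\<Sum>i\<in>UNIV. (cmod (cinner (axis i 1) (\<rho> *v x)))\<^sup>2)"
    by (simp add: cinner_self cinner_axis_left)
  \<comment> \<open>Cauchy-Schwarz against each standard basis vector leaves a diagonal entry as a
    factor; these entries add up to the trace, which is 1.\<close>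
  also have "\<dots> \<le> (\<Sum>i\<in>UNIV. Re (\<rho> $ i $ i) * Re (cinner x (\<rho> *v x)))"
    by (rule sum_mono) (metis pos_semidef_Cauchy_Schwarz[OF psd] diag)
  also have "\<dots> = Re (trace \<rho>) * Re (cinner x (\<rho> *v x))"
    by (simp add: trace_def sum_distrib_right)
  finally show ?thesis by (simp add: tr)
qed

section \<open>The bound on the classical version\<close>

text \<open>Let \<open>R\<close> be the sum of the states. Vanishing products and
  \<open>\<rho>\<^sup>2 \<le> \<rho>\<close> give \<open>R\<^sup>2 \<le> R\<close>, and positivity
  of \<open>(1 - R)\<^sup>2\<close> then yields \<open>R \<le> 1\<close>; this is that operator
  inequality tested on \<open>x\<close>.\<close>

lemma sum_expectations_le:
  assumes "finite I" and states: "\<And>n. n \<in> I \<Longrightarrow> quantum_state (\<rho> n)"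
    and dist: "perfectly_distinguishable I \<rho>"
  shows "(\<Sum>n\<in>I. Re (cinner x (\<rho> n *v x))) \<le> Re (cinner x x)"
proof -
  define y where "y = (\<Sum>n\<in>I. \<rho> n *v x)"
  have herm: "hermitian (\<rho> n)" if "n \<in> I" for n
    using states[OF that] by (simp add: quantum_state_def pos_semidef_def)
  have orth: "cinner (\<rho> m *v x) (\<rho> n *v x) = 0" if "m \<in> I" "n \<in> I" "m \<noteq> n" for m n
  proof -
    have "cinner (\<rho> m *v x) (\<rho> n *v x) = cinner x ((\<rho> m ** \<rho> n) *v x)"
      by (simp add: cinner_hermitian[OF herm[OF that(1)]] matrix_vector_mul_assoc)
    also have "\<dots> = 0"
      using dist that by (simp add: perfectly_distinguishable_def cinner_def)
    finally show ?thesis .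
  qed
  have "cinner y y = (\<Sum>n\<in>I. \<Sum>m\<in>I. cinner (\<rho> m *v x) (\<rho> n *v x))"
    by (simp add: y_def cinner_sum_left cinner_sum_right)
  also have "\<dots> = (\<Sum>n\<in>I. \<Sum>m\<in>I. if m = n then cinner (\<rho> n *v x) (\<rho> n *v x) else 0)"
    by (intro sum.cong refl) (auto simp: orth)
  also have "\<dots> = (\<Sum>n\<in>I. cinner (\<rho> n *v x) (\<rho> n *v x))"
    using \<open>finite I\<close> by simp
  finally have yy: "Re (cinner y y) \<le> (\<Sum>n\<in>I. Re (cinner x (\<rho> n *v x)))"
    by (simp add: sum_mono quantum_state_square_le states)
  have xy: "Re (cinner x y) = (\<Sum>n\<in>I. Re (cinner x (\<rho> n *v x)))"
    by (simp add: y_def cinner_sum_right)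
  have "0 \<le> Re (cinner (x - y) (x - y))"
    by (simp add: cinner_self sum_nonneg)
  also have "\<dots> = Re (cinner x x) - 2 * Re (cinner x y) + Re (cinner y y)"
    using cinner_commute[of y x] by (simp add: cinner_diff_left cinner_diff_right)
  finally show ?thesis using yy xy by linarith
qed

lemma classical_version_le:
  assumes b: "orthonormal_basis b" and "1 \<le> M"
    and \<rho>: "\<forall>n\<in>{1..M}. quantum_state (\<rho> n) \<and> has_classical_version b (\<rho> n) p"
    and dist: "perfectly_distinguishable {1..M} \<rho>"
  shows "p $ k \<le> 1 / real M"
proof -
  have "Re (cinner (b k) (\<rho> n *v b k)) = p $ k" if "n \<in> {1..M}" for n
    using \<rho> that unfolding has_classical_version_def by (metis Re_complex_of_real)
  then have "real M * p $ k = (\<Sum>n\<in>{1..M}. Re (cinner (b k) (\<rho> n *v b k)))"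
    by simp
  also have "\<dots> \<le> Re (cinner (b k) (b k))"
    by (rule sum_expectations_le) (use \<rho> dist in auto)
  also have "\<dots> = 1"
    using b by (simp add: orthonormal_basis_def)
  finally show ?thesis
    using \<open>1 \<le> M\<close> by (simp add: field_simps)
qed

section \<open>Extreme points of the capped simplex\<close>

text \<open>For \<open>1 \<le> M\<close> this is a hypersimplex (vectors in the unit cube with
  coordinate sum \<open>M\<close>) scaled by \<open>1 / M\<close>. It serves as the description of
  the permutohedron by inequalities.\<close>

definition capped_simplex :: "nat \<Rightarrow> (real ^ 'd) set" where
  "capped_simplex M = {p \<in> prob_simplex. \<forall>k. p $ k \<le> 1 / real M}"

lemma convex_capped_simplex: "convex (capped_simplex M)"
proof -
  have "u * x + v * y \<le> c" if "x \<le> c" "y \<le> c" "0 \<le> u" "0 \<le> v" "u + v = 1" for u v x y c :: real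
    by (rule convex_bound_le) (use that in auto)
  then show ?thesis
    by (auto simp: convex_def capped_simplex_def prob_simplex_def sum.distrib
        simp flip: sum_distrib_left)
qed

lemma compact_capped_simplex: "compact (capped_simplex M :: (real ^ 'd) set)"
proof -
  have "capped_simplex M = {p :: real ^ 'd. (\<Sum>k\<in>UNIV. p $ k) = 1} \<inter> cbox 0 (\<chi> k. 1 / real M)"
    by (auto simp: capped_simplex_def prob_simplex_def mem_box_cart)
  moreover have "closed {p :: real ^ 'd. (\<Sum>k\<in>UNIV. p $ k) = 1}"
    by (intro closed_Collect_eq continuous_intros)
  ultimately show ?thesis
    by (simp add: closed_Int_compact)
qed

lemma extreme_point_capped_simplex:
  fixes p :: "real ^ 'd"
  assumes ext: "p extreme_point_of capped_simplex M" and "1 \<le> M"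
  shows "p $ k = 0 \<or> p $ k = 1 / real M"
proof (rule ccontr)
  assume k: "\<not> ?thesis"
  have p: "\<And>i. 0 \<le> p $ i" "(\<Sum>i\<in>UNIV. p $ i) = 1" "\<And>i. p $ i \<le> 1 / real M"
    using ext by (auto simp: extreme_point_of_def capped_simplex_def prob_simplex_def)
  have M: "real M > 0" using \<open>1 \<le> M\<close> by simp
  have strict: "0 < p $ i" "p $ i < 1 / real M" if "p $ i \<noteq> 0" "p $ i \<noteq> 1 / real M" for i
    using p(1)[of i] p(3)[of i] that by linarith+
  \<comment> \<open>Integrality: were \<open>k\<close> the only fractional coordinate, every other
    \<open>real M * p $ j\<close> would be 0 or 1, so \<open>real M * p $ k\<close> would be an
    integer strictly between 0 and 1.\<close>
  have "\<exists>j. j \<noteq> k \<and> p $ j \<noteq> 0 \<and> p $ j \<noteq> 1 / real M"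
  proof (rule ccontr)
    assume "\<not> ?thesis"
    then have "real M * p $ j \<in> \<int>" if "j \<noteq> k" for j
      using that M by fastforce
    then have "(\<Sum>j\<in>UNIV - {k}. real M * p $ j) \<in> \<int>"
      by (intro Ints_sum) auto
    moreover have "(\<Sum>j\<in>UNIV - {k}. real M * p $ j) = real M - real M * p $ k"
      using p(2) by (simp add: sum_diff1 right_diff_distrib flip: sum_distrib_left)
    ultimately have "real M - (real M - real M * p $ k) \<in> \<int>"
      by (metis Ints_diff Ints_of_nat)
    then have "real M * p $ k \<in> \<int>" by simp
    moreover have "0 < real M * p $ k" "real M * p $ k < 1"
      using strict[of k] k M by (auto simp: field_simps)
    ultimately show False
      by (auto elim!: Ints_cases)
  qed
  then obtain j where j: "j \<noteq> k" "p $ j \<noteq> 0" "p $ j \<noteq> 1 / real M"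
    by blast
  \<comment> \<open>The largest mass that can move between \<open>k\<close> and \<open>j\<close> in
    either direction while both coordinates stay between 0 and \<open>1 / real M\<close>.\<close>
  define e where "e = Min {p $ k, 1 / real M - p $ k, p $ j, 1 / real M - p $ j}"
  have e: "0 < e" "e \<le> p $ k" "e \<le> 1 / real M - p $ k" "e \<le> p $ j" "e \<le> 1 / real M - p $ j"
    using strict[of k] strict[of j] k j by (auto simp: e_def)
  define d :: "real ^ 'd" where "d = axis k e - axis j e"
  have d: "d $ i = (if i = k then e else if i = j then - e else 0)" for i
    using j by (auto simp: d_def axis_def)
  have sd: "(\<Sum>i\<in>UNIV. d $ i) = 0"
    by (simp add: d_def axis_def sum_subtractf)
  have sum_pd: "(\<Sum>i\<in>UNIV. (p + d) $ i) = 1" "(\<Sum>i\<in>UNIV. (p - d) $ i) = 1"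
    using p(2) sd by (simp_all add: sum.distrib sum_subtractf)
  have bounds: "0 \<le> (p + d) $ i" "(p + d) $ i \<le> 1 / real M"
      "0 \<le> (p - d) $ i" "(p - d) $ i \<le> 1 / real M" for i
    using p(1)[of i] p(3)[of i] e by (auto simp: d)
  have "p + d \<in> capped_simplex M"
    unfolding capped_simplex_def prob_simplex_def using bounds(1,2) sum_pd(1) by blast
  moreover have "p - d \<in> capped_simplex M"
    unfolding capped_simplex_def prob_simplex_def using bounds(3,4) sum_pd(2) by blast
  moreover have "p = midpoint (p - d) (p + d)"
    by (simp add: midpoint_def vec_eq_iff)
  moreover have "p - d \<noteq> p + d"
  proof
    assume "p - d = p + d"
    then have "(p - d) $ k = (p + d) $ k" by (rule arg_cong)
    then show False using d[of k] e(1) by simp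
  qed
  ultimately show False
    using ext midpoint_in_open_segment[of "p - d" "p + d"] by (auto simp: extreme_point_of_def)
qed

section \<open>Permutations of the flat vector\<close>

text \<open>The rank map is strictly increasing, so it is a bijection from the index type onto
  \<open>{..<CARD('d)}\<close>. This counts the nonzero entries of \<open>flat_vector M\<close> when
  \<open>1 \<le> M\<close>.\<close>

lemma card_rank_less:
  assumes "M \<le> CARD('d :: {finite,linorder})"
  shows "card {k :: 'd. card {j. j < k} < M} = M"
proof -
  let ?r = "\<lambda>k :: 'd. card {j. j < k}"
  have "?r k < ?r l" if "k < l" for k l
    by (rule psubset_card_mono) (use that in auto)
  then have inj: "inj ?r"
    by (intro strict_mono_imp_inj_on strict_monoI)
  have "?r k < CARD('d)" for k
    by (rule psubset_card_mono) auto
  then have "range ?r = {..<CARD('d)}"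
    by (intro card_subset_eq) (auto simp: card_image[OF inj])
  then have "range ?r \<inter> {..<M} = {..<M}"
    using assms by auto
  moreover have "?r ` {k. ?r k < M} = range ?r \<inter> {..<M}"
    by blast
  ultimately have "?r ` {k. ?r k < M} = {..<M}"
    by simp
  then show ?thesis
    by (metis card_image card_lessThan inj inj_on_subset subset_UNIV)
qed

text \<open>On a finite type the complements also have equal size, so a bijection between the sets
  and one between the complements can be glued together.\<close>

lemma ex_permutation_image:
  fixes S T :: "'a::finite set"
  assumes "card S = card T"
  obtains \<pi> where "\<pi> permutes UNIV" "\<And>x. \<pi> x \<in> T \<longleftrightarrow> x \<in> S"
proof -
  obtain f where f: "bij_betw f S T"
    using assms by (metis finite_same_card_bij finite)
  have "card (- S) = card (- T)"
    using assms by (simp add: Compl_eq_Diff_UNIV card_Diff_subset)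
  then obtain g where g: "bij_betw g (- S) (- T)"
    by (metis finite_same_card_bij finite)
  let ?h = "\<lambda>x. if x \<in> S then f x else g x"
  have "bij_betw ?h (S \<union> - S) (T \<union> - T)"
    by (rule bij_betw_disjoint_Un[OF f g]) auto
  then have "?h permutes UNIV"
    by (intro bij_imp_permutes) simp_all
  moreover have "?h x \<in> T \<longleftrightarrow> x \<in> S" for x
    using bij_betwE[OF f] bij_betwE[OF g] by auto
  ultimately show thesis by (rule that)
qed

lemma capped_simplex_subset_permutohedron:
  assumes "1 \<le> M" "M \<le> CARD('d::{finite,linorder})"
  shows "capped_simplex M \<subseteq> (permutohedron M :: (real ^ 'd::{finite,linorder}) set)"
proof -
  have "p \<in> {(\<chi> k. flat_vector M $ \<pi> k) | \<pi>. \<pi> permutes UNIV}"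
    if ext: "p extreme_point_of capped_simplex M" for p :: "real ^ 'd::{finite,linorder}"
  proof -
    define S where "S = {k. p $ k = 1 / real M}"
    have vals: "p $ k = (if k \<in> S then 1 / real M else 0)" for k
      using extreme_point_capped_simplex[OF ext \<open>1 \<le> M\<close>, of k] by (auto simp: S_def)
    have "(\<Sum>k\<in>UNIV. p $ k) = 1"
      using ext by (simp add: extreme_point_of_def capped_simplex_def prob_simplex_def)
    \<comment> \<open>Every entry is 0 or \<open>1 / real M\<close>, so total mass 1 fixes the size
      of the support.\<close>
    then have "real (card S) / real M = 1"
      by (auto simp: vals sum.If_cases)
    then have "card S = M"
      using \<open>1 \<le> M\<close> by auto
    then have "card S = card {k :: 'd. card {j. j < k} < M}"
      using card_rank_less[OF assms(2)] by simp
    \<comment> \<open>\<open>\<pi>\<close> must send the support of \<open>p\<close> to the first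
      \<open>M\<close> positions, because the permuted vector reads \<open>flat_vector M\<close> at
      \<open>\<pi> k\<close>.\<close>
    then obtain \<pi> where "\<pi> permutes UNIV" "\<And>k. \<pi> k \<in> {k. card {j. j < k} < M} \<longleftrightarrow> k \<in> S"
      using ex_permutation_image by blast
    then show ?thesis
      by (auto simp: vec_eq_iff vals flat_vector_def intro!: exI[of _ \<pi>])
  qed
  then have "convex hull {p :: real ^ 'd::{finite,linorder}. p extreme_point_of capped_simplex M}
      \<subseteq> permutohedron M"
    unfolding permutohedron_def by (intro hull_mono) blast
  then show ?thesis
    using Krein_Milman_Minkowski[OF compact_capped_simplex convex_capped_simplex] by metis
qed

theorem proposition4:
  fixes b :: "'d \<Rightarrow> complex ^ 'd::{finite,linorder}" and M :: nat
  assumes "orthonormal_basis b"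
    and "1 \<le> M" and "M \<le> CARD('d)"
  shows "(\<forall>p\<in>prob_simplex.
            (\<exists>\<rho> :: nat \<Rightarrow> complex ^ 'd::{finite,linorder} ^ 'd::{finite,linorder}.
               (\<forall>n\<in>{1..M}. quantum_state (\<rho> n) \<and> has_classical_version b (\<rho> n) p) \<and>
               perfectly_distinguishable {1..M} \<rho>) \<longrightarrow>
            Max (range (\<lambda>k. p $ k)) \<le> 1 / real M) \<and>
         distinguishability_region b M \<subseteq> permutohedron M"
proof
  show "\<forall>p\<in>prob_simplex.
            (\<exists>\<rho> :: nat \<Rightarrow> complex ^ 'd::{finite,linorder} ^ 'd::{finite,linorder}.
               (\<forall>n\<in>{1..M}. quantum_state (\<rho> n) \<and> has_classical_version b (\<rho> n) p) \<and>
               perfectly_distinguishable {1..M} \<rho>) \<longrightarrow>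
            Max (range (\<lambda>k. p $ k)) \<le> 1 / real M"
    using classical_version_le[OF assms(1,2)] by auto
  have "distinguishability_region b M \<subseteq> capped_simplex M"
    using classical_version_le[OF assms(1,2)]
    by (auto simp: distinguishability_region_def capped_simplex_def)
  then show "distinguishability_region b M \<subseteq> permutohedron M"
    using capped_simplex_subset_permutohedron[OF assms(2,3)] by blast
qed

end
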